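(* Let $(a(n))_{n=0}^\infty$ be a sequence of complex numbers with the property that $$\sum_{j\ge0}\left[\sum_{2^j\le n<2^{j+1}}|a(n)|\right]^2<\infty.$$ Then the sequence $(a(n)\hat f(n))_{n=0}^\infty$ belongs to $\ell^1$ for every function $f$ in $H^1$.
   Context: For $f\in L^1(-\pi,\pi]$, the Fourier coefficients are $\hat f(n)=\frac{1}{2\pi}\int_{-\pi}^{\pi}f(t)e^{-int}\,dt$, $n\in\mathbb{Z}$. The space $H^1$ is the set of $f\in L^1(-\pi,\pi]$ with $\hat f(n)=0$ for all $n<0$. *)

theory Defs
  imports "HOL-Analysis.Analysis"
begin

text \<open>
  Elements of \<open>L\<^sup>1(-\<pi>, \<pi>]\<close> are represented by functions on the whole real line; values outside
  the interval are ignored. Measurability is with respect to the completed Lebesgue measure, and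
  almost everywhere equal functions are not identified.
\<close>

definition fourier_coeff :: "(real \<Rightarrow> complex) \<Rightarrow> int \<Rightarrow> complex" where
  "fourier_coeff f n =
     1 / (2 * of_real pi) *
       (LINT t:{-pi<..pi}|lebesgue. f t * exp (- (\<i> * of_int n * of_real t)))"

definition hardy_H1 :: "(real \<Rightarrow> complex) set" where
  "hardy_H1 =
     {f. set_integrable lebesgue {-pi<..pi} f \<and> (\<forall>n<0. fourier_coeff f n = 0)}"

end

(*
The condition on a pairs, by Cauchy-Schwarz over the dyadic blocks, with Paley's inequality: if
m(j) lies in the j-th dyadic block and f is in H^1, then the sum of |fhat(m(j))|^2 is at most
8 (||f||_1 / (2 pi))^2; one takes for m(j) the place where |fhat| is largest on the block. Fejer
means lie in H^1 with no larger L^1 norm, so Paley's inequality need only be shown for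
polynomials p. Reflecting the zeros of p inside the unit disc gives a polynomial q without zeros
there, with |q| = |p| on the circle and |p| <= |q| inside. Then p = g h with g = sqrt q and
h = p / g, and |g|^2, |h|^2 <= |q| in the disc, so the coefficients of g and h are square
summable with sum at most ||p||_1 / (2 pi). In the n-th coefficient of g h each term carries an
index k >= n/2 of g or of h, and such k <= n meet only two dyadic scales.
*)

theory Submission
  imports Defs "HOL-Complex_Analysis.Laurent_Convergence"
    "HOL-Computational_Algebra.Fundamental_Theorem_Algebra"
begin

section \<open>Orthogonality of exponentials and square sums of Taylor coefficients\<close>

lemma integral_cis_int:
  "integral {-pi..pi} (\<lambda>t. cis (of_int n * t)) = (if n = 0 then 2 * of_real pi else 0)"
proof (cases "n = 0")
  case True
  then show ?thesis by (simp add: scaleR_conv_of_real)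
next
  case False
  let ?F = "\<lambda>t. cis (of_int n * t) / (\<i> * of_int n)"
  have "((\<lambda>t. cis (of_int n * t)) has_integral ?F pi - ?F (- pi)) {-pi..pi}"
  proof (rule fundamental_theorem_of_calculus)
    fix t :: real
    have "((\<lambda>z. exp (\<i> * of_int n * z) / (\<i> * of_int n)) has_field_derivative
        exp (\<i> * of_int n * of_real t)) (at (of_real t))"
      using False by (auto intro!: derivative_eq_intros)
    then have "((\<lambda>t. exp (\<i> * of_int n * of_real t) / (\<i> * of_int n)) has_vector_derivative
        exp (\<i> * of_int n * of_real t)) (at t within {-pi..pi})"
      by (rule has_vector_derivative_real_field)
    then show "(?F has_vector_derivative cis (of_int n * t)) (at t within {-pi..pi})"
      by (simp add: cis_conv_exp mult.assoc)
  qed simp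
  \<comment> \<open>The antiderivative takes the same value at both endpoints by periodicity, so the
    boundary terms cancel.\<close>
  moreover have "cis (of_int n * pi) = cis (of_int n * (- pi))"
    by (simp add: complex_eq_iff sin_npi_int mult.commute[of _ pi])
  ultimately show ?thesis
    using False by (simp add: integral_unique)
qed

lemma parseval_poly:
  fixes c :: "nat \<Rightarrow> complex"
  shows "integral {-pi..pi} (\<lambda>t. (cmod (\<Sum>k<M. c k * cis t ^ k))\<^sup>2) = 2 * pi * (\<Sum>k<M. (cmod (c k))\<^sup>2)"
proof -
  have "of_real (integral {-pi..pi} (\<lambda>t. (cmod (\<Sum>k<M. c k * cis t ^ k))\<^sup>2))
      = integral {-pi..pi} (\<lambda>t. of_real ((cmod (\<Sum>k<M. c k * cis t ^ k))\<^sup>2) :: complex)"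
    by (intro integral_linear[OF _ bounded_linear_of_real, unfolded o_def, symmetric]
          integrable_continuous_interval continuous_intros)
  also have "\<dots> = integral {-pi..pi} (\<lambda>t. \<Sum>j<M. \<Sum>k<M. c j * cnj (c k) * cis (of_int (int j - int k) * t))"
  proof (rule integral_cong)
    fix t :: real
    have "cis t ^ j * cnj (cis t ^ k) = cis (of_int (int j - int k) * t)" for j k
      by (simp add: Complex.DeMoivre cis_cnj cis_mult algebra_simps)
    then show "of_real ((cmod (\<Sum>k<M. c k * cis t ^ k))\<^sup>2)
        = (\<Sum>j<M. \<Sum>k<M. c j * cnj (c k) * cis (of_int (int j - int k) * t))"
      by (simp add: complex_norm_square sum_product mult_ac flip: of_real_power)
  qed
  also have "\<dots> = (\<Sum>j<M. \<Sum>k<M. c j * cnj (c k) * integral {-pi..pi} (\<lambda>t. cis (of_int (int j - int k) * t)))"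
    by (subst integral_sum; (intro integrable_sum integrable_continuous_interval continuous_intros)?; simp?)+
  also have "\<dots> = (\<Sum>j<M. c j * cnj (c j) * (2 * of_real pi))"
    by (intro sum.cong refl) (simp add: integral_cis_int if_distrib cong: if_cong del: of_int_diff)
  also have "\<dots> = of_real (2 * pi * (\<Sum>k<M. (cmod (c k))\<^sup>2))"
    by (simp add: complex_norm_square sum_distrib_left mult_ac flip: of_real_power)
  finally show ?thesis
    using of_real_eq_iff by blast
qed

text \<open>Parseval holds for each partial sum on the circle of radius \<open>r\<close>. These
  partial sums are dominated by the constant \<open>suminf (\<lambda>k. norm (c k))\<close>, so the
  integrals converge, and the first \<open>K\<close> terms stay below the limit.\<close>

lemma bessel_power_series:
  fixes g :: "nat \<Rightarrow> complex" and r :: real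
  assumes sums: "\<And>z. norm z < 1 \<Longrightarrow> (\<lambda>k. g k * z ^ k) sums G z" and r: "0 \<le> r" "r < 1"
  shows "2 * pi * (\<Sum>k<K. (cmod (g k))\<^sup>2 * r ^ (2 * k)) \<le> integral {-pi..pi} (\<lambda>t. (cmod (G (of_real r * cis t)))\<^sup>2)"
proof -
  define c where "c = (\<lambda>k. g k * of_real r ^ k)"
  let ?S = "\<lambda>M t. \<Sum>k<M. c k * cis t ^ k"
  \<comment> \<open>Convergence at a slightly larger radius \<open>s\<close> gives absolute
    convergence at radius \<open>r\<close>.\<close>
  obtain s where s: "r < s" "s < 1" using r dense by blast
  have "summable (\<lambda>k. norm (g k * of_real r ^ k))"
    using sums[of "of_real s"] s r by (intro powser_insidea[of _ "of_real s"]) (auto simp: sums_iff)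
  then have sm: "summable (\<lambda>k. norm (c k))" by (simp add: c_def)
  have lim: "(\<lambda>M. integral {-pi..pi} (\<lambda>t. (cmod (?S M t))\<^sup>2)) \<longlonglongrightarrow>
      integral {-pi..pi} (\<lambda>t. (cmod (G (of_real r * cis t)))\<^sup>2)"
  proof (rule dominated_convergence(2))
    show "(\<lambda>t. (cmod (?S M t))\<^sup>2) integrable_on {-pi..pi}" for M
      by (intro integrable_continuous_interval continuous_intros)
    show "(\<lambda>t. (suminf (\<lambda>k. norm (c k)))\<^sup>2) integrable_on {-pi..pi}"
      by (intro integrable_continuous_interval continuous_intros)
    show "norm ((cmod (?S M t))\<^sup>2) \<le> (suminf (\<lambda>k. norm (c k)))\<^sup>2" for M t
    proof -
      have "cmod (?S M t) \<le> (\<Sum>k<M. norm (c k))"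
        by (rule order_trans[OF norm_sum]) (simp add: norm_mult norm_power)
      also have "\<dots> \<le> suminf (\<lambda>k. norm (c k))"
        by (intro sum_le_suminf sm) auto
      finally show ?thesis by (simp add: power_mono)
    qed
    show "(\<lambda>M. (cmod (?S M t))\<^sup>2) \<longlonglongrightarrow> (cmod (G (of_real r * cis t)))\<^sup>2" for t
    proof -
      have "(\<lambda>k. g k * (of_real r * cis t) ^ k) sums G (of_real r * cis t)"
        using r by (intro sums) (simp add: norm_mult)
      then have "(\<lambda>M. ?S M t) \<longlonglongrightarrow> G (of_real r * cis t)"
        by (simp add: sums_def c_def power_mult_distrib mult.assoc)
      then show ?thesis by (intro tendsto_intros)
    qed
  qed
  show ?thesis
  proof (rule LIMSEQ_le_const[OF lim], intro exI[of _ K] allI impI)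
    fix M assume "K \<le> M"
    have "(\<Sum>k<K. (cmod (g k))\<^sup>2 * r ^ (2 * k)) = (\<Sum>k<K. (cmod (c k))\<^sup>2)"
      using r by (simp add: c_def norm_mult norm_power power_mult_distrib power_mult power_even_eq flip: power_mult)
    also have "\<dots> \<le> (\<Sum>k<M. (cmod (c k))\<^sup>2)"
      using \<open>K \<le> M\<close> by (intro sum_mono2) auto
    finally show "2 * pi * (\<Sum>k<K. (cmod (g k))\<^sup>2 * r ^ (2 * k)) \<le> integral {-pi..pi} (\<lambda>t. (cmod (?S M t))\<^sup>2)"
      by (simp add: parseval_poly)
  qed
qed

text \<open>\<open>G\<close> is controlled only in the open disc, so the coefficients are bounded on
  circles of radius \<open>r < 1\<close> first. The majorant is a polynomial, hence bounded on the
  closed disc, and its integrals converge as the radius tends to 1; on the left the sum is finite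
  and the limit is immediate.\<close>

lemma square_sum_le_of_majorant:
  fixes p :: "complex poly"
  assumes sums: "\<And>z. norm z < 1 \<Longrightarrow> (\<lambda>k. g k * z ^ k) sums G z"
    and cont: "continuous_on (ball 0 1) G"
    and le: "\<And>z. norm z < 1 \<Longrightarrow> (cmod (G z))\<^sup>2 \<le> cmod (poly p z)"
  shows "2 * pi * (\<Sum>k<K. (cmod (g k))\<^sup>2) \<le> integral {-pi..pi} (\<lambda>t. cmod (poly p (cis t)))"
proof -
  define r :: "nat \<Rightarrow> real" where "r = (\<lambda>n. 1 - inverse (real (Suc n)))"
  have r: "0 \<le> r n" "r n < 1" for n
    by (auto simp: r_def field_simps)
  have r1: "r \<longlonglongrightarrow> 1"
    unfolding r_def using LIMSEQ_inverse_real_of_nat_add_minus[of 1] by simp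
  have "bounded (poly p ` cball 0 1)"
    by (intro compact_imp_bounded compact_continuous_image continuous_intros compact_cball)
  then obtain B where B: "\<And>z. norm z \<le> 1 \<Longrightarrow> cmod (poly p z) \<le> B"
    unfolding bounded_iff by (metis image_eqI mem_cball_0)
  have lim: "(\<lambda>n. integral {-pi..pi} (\<lambda>t. cmod (poly p (of_real (r n) * cis t)))) \<longlonglongrightarrow>
      integral {-pi..pi} (\<lambda>t. cmod (poly p (cis t)))"
  proof (rule dominated_convergence(2))
    show "(\<lambda>t. cmod (poly p (of_real (r n) * cis t))) integrable_on {-pi..pi}" for n
      by (intro integrable_continuous_interval continuous_intros)
    show "(\<lambda>t. B) integrable_on {-pi..pi}"
      by (intro integrable_continuous_interval continuous_intros)
    show "norm (cmod (poly p (of_real (r n) * cis t))) \<le> B" for n t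
      using r[of n] by (auto intro!: B simp: norm_mult)
    show "(\<lambda>n. cmod (poly p (of_real (r n) * cis t))) \<longlonglongrightarrow> cmod (poly p (cis t))" for t
    proof -
      have "(\<lambda>n. of_real (r n) * cis t) \<longlonglongrightarrow> of_real 1 * cis t"
        by (intro tendsto_intros r1)
      then show ?thesis by (intro tendsto_intros) simp
    qed
  qed
  have "(\<lambda>n. 2 * pi * (\<Sum>k<K. (cmod (g k))\<^sup>2 * r n ^ (2 * k))) \<longlonglongrightarrow> 2 * pi * (\<Sum>k<K. (cmod (g k))\<^sup>2 * 1 ^ (2 * k))"
    by (intro tendsto_intros r1)
  then have lim2: "(\<lambda>n. 2 * pi * (\<Sum>k<K. (cmod (g k))\<^sup>2 * r n ^ (2 * k))) \<longlonglongrightarrow> 2 * pi * (\<Sum>k<K. (cmod (g k))\<^sup>2)"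
    by simp
  show ?thesis
  proof (rule LIMSEQ_le[OF lim2 lim], intro exI allI impI)
    fix n
    have inb: "norm (of_real (r n) * cis t) < 1" for t
      using r[of n] by (simp add: norm_mult)
    have "2 * pi * (\<Sum>k<K. (cmod (g k))\<^sup>2 * r n ^ (2 * k)) \<le> integral {-pi..pi} (\<lambda>t. (cmod (G (of_real (r n) * cis t)))\<^sup>2)"
      by (rule bessel_power_series[OF sums r])
    also have "\<dots> \<le> integral {-pi..pi} (\<lambda>t. cmod (poly p (of_real (r n) * cis t)))"
    proof (rule integral_le)
      show "(\<lambda>t. (cmod (G (of_real (r n) * cis t)))\<^sup>2) integrable_on {-pi..pi}"
        using inb by (intro integrable_continuous_interval continuous_intros continuous_on_compose2[OF cont]) auto
      show "(\<lambda>t. cmod (poly p (of_real (r n) * cis t))) integrable_on {-pi..pi}"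
        by (intro integrable_continuous_interval continuous_intros)
    qed (use inb le in auto)
    finally show "2 * pi * (\<Sum>k<K. (cmod (g k))\<^sup>2 * r n ^ (2 * k)) \<le> integral {-pi..pi} (\<lambda>t. cmod (poly p (of_real (r n) * cis t)))" .
  qed
qed

section \<open>Reflection of zeros and factorization into two square summable series\<close>

lemma norm_one_sub_cnj_mult_diff:
  "(cmod (1 - cnj a * z))\<^sup>2 - (cmod (z - a))\<^sup>2 = (1 - (cmod a)\<^sup>2) * (1 - (cmod z)\<^sup>2)"
  unfolding cmod_power2 by (simp add: algebra_simps power2_eq_square)

text \<open>This is the bound by 1 for a Blaschke factor, with denominators cleared: the difference
  of the squared moduli is a product of two nonnegative factors. On the circle one of them vanishes,
  which gives the equality in the next lemma.\<close>

lemma norm_sub_le_norm_one_sub_cnj_mult: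
  assumes "cmod a \<le> 1" "cmod z \<le> 1"
  shows "cmod (z - a) \<le> cmod (1 - cnj a * z)"
proof -
  have "(1 - (cmod a)\<^sup>2) * (1 - (cmod z)\<^sup>2) \<ge> 0"
    using assms by (intro mult_nonneg_nonneg) (simp_all add: power_le_one)
  then have "(cmod (z - a))\<^sup>2 \<le> (cmod (1 - cnj a * z))\<^sup>2"
    using norm_one_sub_cnj_mult_diff[of a z] by linarith
  then show ?thesis
    by (rule power2_le_imp_le) simp
qed

lemma norm_sub_eq_norm_one_sub_cnj_mult:
  assumes "cmod z = 1"
  shows "cmod (z - a) = cmod (1 - cnj a * z)"
  using norm_one_sub_cnj_mult_diff[of a z] assms by (simp add: power2_eq_iff_nonneg)

text \<open>Each factor \<open>z - a\<close> with \<open>norm a < 1\<close> is replaced by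
  \<open>1 - cnj a * z\<close>, which has no zero in the disc; this divides \<open>p\<close> by a
  Blaschke product. Zeros on the unit circle are kept, so \<open>q\<close> is zero free only in the
  open disc.\<close>

lemma reflect_roots:
  fixes p :: "complex poly"
  assumes "p \<noteq> 0"
  obtains q where "\<And>z. norm z < 1 \<Longrightarrow> poly q z \<noteq> 0"
    and "\<And>z. norm z < 1 \<Longrightarrow> cmod (poly p z) \<le> cmod (poly q z)"
    and "\<And>z. norm z = 1 \<Longrightarrow> cmod (poly q z) = cmod (poly p z)"
proof -
  obtain a where a: "smult (lead_coeff p) (\<Prod>i<degree p. [:-a i, 1:]) = p"
    using complex_poly_decompose' by blast
  define b where "b i = (if norm (a i) < 1 then [:1, - cnj (a i):] else [:-a i, 1:])" for i
  define q where "q = smult (lead_coeff p) (\<Prod>i<degree p. b i)"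
  have p: "poly p z = lead_coeff p * (\<Prod>i<degree p. z - a i)" for z
    by (subst a[symmetric]) (simp add: poly_prod)
  have q: "poly q z = lead_coeff p * (\<Prod>i<degree p. poly (b i) z)" for z
    by (simp add: q_def poly_prod)
  show ?thesis
  proof
    fix z :: complex assume z: "norm z < 1"
    have "poly (b i) z \<noteq> 0" for i
    proof (cases "norm (a i) < 1")
      case True
      have "norm (cnj (a i) * z) < 1"
        using mult_strict_mono'[of "norm (a i)" 1 "norm z" 1] True z by (simp add: norm_mult)
      then show ?thesis using True by (auto simp: b_def algebra_simps)
    next
      case False
      then show ?thesis using z by (auto simp: b_def)
    qed
    then show "poly q z \<noteq> 0" using assms by (simp add: q)
    have "cmod (z - a i) \<le> cmod (poly (b i) z)" for i
      using norm_sub_le_norm_one_sub_cnj_mult[of "a i" z] z by (simp add: b_def algebra_simps)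
    then show "cmod (poly p z) \<le> cmod (poly q z)"
      unfolding p q norm_mult prod_norm[symmetric] by (intro mult_left_mono prod_mono) auto
  next
    fix z :: complex assume z: "norm z = 1"
    have "cmod (poly (b i) z) = cmod (z - a i)" for i
      using norm_sub_eq_norm_one_sub_cnj_mult[of z "a i"] z by (simp add: b_def algebra_simps)
    then show "cmod (poly q z) = cmod (poly p z)"
      unfolding p q norm_mult prod_norm[symmetric] by simp
  qed
qed

lemma poly_has_fps_expansion: "poly p has_fps_expansion fps_of_poly (p :: complex poly)"
  unfolding has_fps_expansion_def by simp

text \<open>A zero-free \<open>q\<close> has a holomorphic square root \<open>G\<close> on the
  contractible disc. \<open>G\<close> and \<open>H = p / G\<close> need not be polynomials, so the
  coefficient identity comes from uniqueness of Taylor expansions at 0. Both are majorized by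
  \<open>q\<close>, whose integral over the circle equals that of \<open>p\<close>.\<close>

lemma poly_factor_square_summable:
  fixes p :: "complex poly"
  obtains g h :: "nat \<Rightarrow> complex"
  where "\<And>n. coeff p n = (\<Sum>k\<le>n. g k * h (n - k))"
    and "\<And>K. 2 * pi * (\<Sum>k<K. (cmod (g k))\<^sup>2) \<le> integral {-pi..pi} (\<lambda>t. cmod (poly p (cis t)))"
    and "\<And>K. 2 * pi * (\<Sum>k<K. (cmod (h k))\<^sup>2) \<le> integral {-pi..pi} (\<lambda>t. cmod (poly p (cis t)))"
proof (cases "p = 0")
  case True
  then show ?thesis using that[of "\<lambda>_. 0" "\<lambda>_. 0"] by simp
next
  case False
  then obtain q where q: "\<And>z. norm z < 1 \<Longrightarrow> poly q z \<noteq> 0"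
    "\<And>z. norm z < 1 \<Longrightarrow> cmod (poly p z) \<le> cmod (poly q z)"
    "\<And>z. norm z = 1 \<Longrightarrow> cmod (poly q z) = cmod (poly p z)"
    by (rule reflect_roots) blast
  obtain G where G: "G holomorphic_on ball 0 1" "\<And>z. z \<in> ball 0 1 \<Longrightarrow> poly q z = G z ^ 2"
    by (rule contractible_imp_holomorphic_sqrt[of "poly q" "ball 0 1"])
       (use q in \<open>auto intro!: holomorphic_intros convex_imp_contractible\<close>)
  have Gnz: "G z \<noteq> 0" if "z \<in> ball 0 1" for z
    using q(1)[of z] G(2)[OF that] that by auto
  define H where "H = (\<lambda>z. poly p z / G z)"
  have H: "H holomorphic_on ball 0 1"
    unfolding H_def using Gnz by (intro holomorphic_intros G) auto
  define g where "g = fps_nth (fps_expansion G 0)"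
  define h where "h = fps_nth (fps_expansion H 0)"
  have eG: "G has_fps_expansion fps_expansion G 0" and eH: "H has_fps_expansion fps_expansion H 0"
    using G H by (auto intro!: has_fps_expansion_fps_expansion[of "ball 0 1"])
  have "(\<lambda>z. G z * H z) has_fps_expansion fps_expansion G 0 * fps_expansion H 0"
    by (intro has_fps_expansion_mult eG eH)
  \<comment> \<open>\<open>G * H = p\<close> near 0 is all that a comparison of expansions at 0
    requires.\<close>
  moreover have "eventually (\<lambda>z. z \<in> ball 0 1) (nhds (0::complex))"
    by (intro eventually_nhds_in_open) auto
  then have "eventually (\<lambda>z. G z * H z = poly p z) (nhds 0)"
    by eventually_elim (use Gnz in \<open>simp add: H_def\<close>)
  ultimately have "poly p has_fps_expansion fps_expansion G 0 * fps_expansion H 0"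
    by (simp cong: has_fps_expansion_cong)
  then have eq: "fps_of_poly p = fps_expansion G 0 * fps_expansion H 0"
    using fps_expansion_unique_complex poly_has_fps_expansion by blast
  have sG: "(\<lambda>k. g k * z ^ k) sums G z" if "norm z < 1" for z
    unfolding g_def using that by (intro has_fps_expansion_imp_sums_complex[OF eG, of 1]) (use G in auto)
  have sH: "(\<lambda>k. h k * z ^ k) sums H z" if "norm z < 1" for z
    unfolding h_def using that by (intro has_fps_expansion_imp_sums_complex[OF eH, of 1]) (use H in auto)
  have int: "integral {-pi..pi} (\<lambda>t. cmod (poly q (cis t))) = integral {-pi..pi} (\<lambda>t. cmod (poly p (cis t)))"
    by (simp add: q(3))
  have nG: "(cmod (G z))\<^sup>2 = cmod (poly q z)" if "norm z < 1" for z
    using G(2)[of z] that by (simp add: norm_power)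
  have nH: "(cmod (H z))\<^sup>2 \<le> cmod (poly q z)" if "norm z < 1" for z
  proof -
    have "(cmod (H z))\<^sup>2 = (cmod (poly p z))\<^sup>2 / cmod (poly q z)"
      using nG[OF that] by (simp add: H_def norm_divide power_divide)
    also have "\<dots> \<le> (cmod (poly q z))\<^sup>2 / cmod (poly q z)"
      using q(2)[OF that] by (intro divide_right_mono power_mono) auto
    finally show ?thesis using q(1)[OF that] by (simp add: power2_eq_square)
  qed
  show ?thesis
  proof
    show "coeff p n = (\<Sum>k\<le>n. g k * h (n - k))" for n
      using arg_cong[OF eq, of "\<lambda>F. fps_nth F n"] by (simp add: fps_mult_nth g_def h_def atLeast0AtMost)
    show "2 * pi * (\<Sum>k<K. (cmod (g k))\<^sup>2) \<le> integral {-pi..pi} (\<lambda>t. cmod (poly p (cis t)))" for K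
      using square_sum_le_of_majorant[OF sG holomorphic_on_imp_continuous_on[OF G(1)], of q K] nG int by simp
    show "2 * pi * (\<Sum>k<K. (cmod (h k))\<^sup>2) \<le> integral {-pi..pi} (\<lambda>t. cmod (poly p (cis t)))" for K
      using square_sum_le_of_majorant[OF sH holomorphic_on_imp_continuous_on[OF H], of q K] nH int by simp
  qed
qed

section \<open>Cauchy products sampled once in each dyadic block\<close>

lemma card_dyadic_scales_le:
  fixes x :: nat
  shows "card {j. j < J \<and> 2 ^ j \<le> x \<and> x < 2 ^ (j + 2)} \<le> 2"
proof (cases "{j. j < J \<and> 2 ^ j \<le> x \<and> x < 2 ^ (j + 2)} = {}")
  case False
  let ?S = "{j. j < J \<and> 2 ^ j \<le> x \<and> x < 2 ^ (j + 2)}"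
  have fin: "finite ?S" by simp
  have M: "Max ?S \<in> ?S" using fin False by (rule Max_in)
  \<comment> \<open>If \<open>M\<close> is the largest such scale, then
    \<open>2 ^ M \<le> x < 2 ^ (j + 2)\<close> forces \<open>M < j + 2\<close>. For
    \<open>M = 0\<close> the truncated \<open>M - 1\<close> is again 0, which does no harm.\<close>
  have "?S \<subseteq> {Max ?S - 1, Max ?S}"
  proof
    fix j assume j: "j \<in> ?S"
    then have "j \<le> Max ?S" using fin by simp
    moreover have "(2::nat) ^ Max ?S < 2 ^ (j + 2)"
      using M j by (auto intro: le_less_trans)
    then have "Max ?S < j + 2" by (simp only: power_strict_increasing_iff)
    ultimately show "j \<in> {Max ?S - 1, Max ?S}" by auto
  qed
  then have "card ?S \<le> card {Max ?S - 1, Max ?S}" by (intro card_mono) auto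
  also have "\<dots> \<le> 2" by (simp add: card_insert_le_m1)
  finally show ?thesis .
next
  case True
  show ?thesis unfolding True by simp
qed

text \<open>After the two sums are interchanged, each \<open>k\<close> is counted once for every
  scale \<open>j\<close> with \<open>2 ^ j \<le> 2 * k < 2 ^ (j + 2)\<close>, hence at most twice.
  The doubled index avoids halving natural numbers.\<close>

lemma sum_dyadic_overlap_le:
  fixes y :: "nat \<Rightarrow> real"
  assumes y: "\<And>k. y k \<ge> 0" and A: "\<And>K. (\<Sum>k<K. y k) \<le> A"
  shows "(\<Sum>j<J. \<Sum>k | k < 2 ^ (j + 1) \<and> 2 ^ j \<le> 2 * k. y k) \<le> 2 * A"
proof -
  \<comment> \<open>The common bound \<open>2 ^ J\<close>, independent of \<open>j\<close>, puts the
    double sum into the form in which it can be swapped.\<close>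
  have "{k::nat. k < 2 ^ (j + 1) \<and> 2 ^ j \<le> 2 * k} = {k. k \<in> {..<2 ^ J} \<and> 2 ^ j \<le> 2 * k \<and> 2 * k < 2 ^ (j + 2)}"
    if "j < J" for j
  proof -
    have "(2::nat) ^ (j + 1) \<le> 2 ^ J" using that by (intro power_increasing) auto
    then show ?thesis by auto
  qed
  then have "(\<Sum>j<J. \<Sum>k | k < 2 ^ (j + 1) \<and> 2 ^ j \<le> 2 * k. y k)
      = (\<Sum>j<J. \<Sum>k | k \<in> {..<2 ^ J} \<and> 2 ^ j \<le> 2 * k \<and> 2 * k < 2 ^ (j + 2). y k)"
    by (intro sum.cong) auto
  also have "\<dots> = (\<Sum>k<2 ^ J. \<Sum>j | j \<in> {..<J} \<and> 2 ^ j \<le> 2 * k \<and> 2 * k < 2 ^ (j + 2). y k)"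
    by (rule sum.swap_restrict) auto
  also have "\<dots> \<le> (\<Sum>k<2 ^ J. 2 * y k)"
  proof (rule sum_mono)
    fix k :: nat
    have "real (card {j. j < J \<and> 2 ^ j \<le> 2 * k \<and> 2 * k < 2 ^ (j + 2)}) \<le> real 2"
      by (intro of_nat_mono card_dyadic_scales_le)
    then show "(\<Sum>j | j \<in> {..<J} \<and> 2 ^ j \<le> 2 * k \<and> 2 * k < 2 ^ (j + 2). y k) \<le> 2 * y k"
      using y[of k] by (simp add: mult_right_mono)
  qed
  also have "\<dots> \<le> 2 * A" using A[of "2 ^ J"] by (simp flip: sum_distrib_left)
  finally show ?thesis .
qed

text \<open>The constant 8 is \<open>2 * (2 + 2)\<close>: a factor 2 from
  \<open>(X + Y)^2 \<le> 2 * (X^2 + Y^2)\<close>, and for each of \<open>g\<close> and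
  \<open>h\<close> a factor 2 from the overlap of the dyadic ranges.\<close>

lemma dyadic_cauchy_product_le:
  fixes g h :: "nat \<Rightarrow> complex"
  assumes g: "\<And>K. (\<Sum>k<K. (cmod (g k))\<^sup>2) \<le> A" and h: "\<And>K. (\<Sum>k<K. (cmod (h k))\<^sup>2) \<le> A"
    and m: "\<And>j. m j \<in> {2 ^ j..<2 ^ (j + 1)}"
  shows "(\<Sum>j<J. (cmod (\<Sum>k\<le>m j. g k * h (m j - k)))\<^sup>2) \<le> 8 * A\<^sup>2"
proof -
  let ?D = "\<lambda>j::nat. {k::nat. k < 2 ^ (j + 1) \<and> 2 ^ j \<le> 2 * k}"
  have A: "A \<ge> 0" using g[of 0] by simp
  \<comment> \<open>Here \<open>u\<close> carries the large index, so its square sum is confined to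
    the range \<open>?D j\<close>, while the square sum of \<open>v\<close> is simply bounded by
    \<open>A\<close>. It is used with \<open>u, v\<close> equal to \<open>g, h\<close> and to
    \<open>h, g\<close>.\<close>
  have half: "(\<Sum>k | k \<le> m j \<and> m j \<le> 2 * k. cmod (u k) * cmod (v (m j - k)))\<^sup>2 \<le> (\<Sum>k\<in>?D j. (cmod (u k))\<^sup>2) * A"
    if v: "\<And>K. (\<Sum>k<K. (cmod (v k))\<^sup>2) \<le> A" for u v :: "nat \<Rightarrow> complex" and j
  proof -
    let ?E = "{k. k \<le> m j \<and> m j \<le> 2 * k}"
    have "(\<Sum>k\<in>?E. cmod (u k) * cmod (v (m j - k)))\<^sup>2
        \<le> (\<Sum>k\<in>?E. (cmod (u k))\<^sup>2) * (\<Sum>k\<in>?E. (cmod (v (m j - k)))\<^sup>2)"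
      by (rule Cauchy_Schwarz_ineq_sum)
    also have "\<dots> \<le> (\<Sum>k\<in>?D j. (cmod (u k))\<^sup>2) * A"
    proof (rule mult_mono)
      show "(\<Sum>k\<in>?E. (cmod (u k))\<^sup>2) \<le> (\<Sum>k\<in>?D j. (cmod (u k))\<^sup>2)"
        using m[of j] by (intro sum_mono2) auto
      have "(\<Sum>k\<in>?E. (cmod (v (m j - k)))\<^sup>2) = (\<Sum>k\<in>(\<lambda>k. m j - k) ` ?E. (cmod (v k))\<^sup>2)"
        by (subst sum.reindex) (auto simp: inj_on_def)
      also have "\<dots> \<le> (\<Sum>k<Suc (m j). (cmod (v k))\<^sup>2)"
        by (intro sum_mono2) auto
      also have "\<dots> \<le> A" by (rule v)
      finally show "(\<Sum>k\<in>?E. (cmod (v (m j - k)))\<^sup>2) \<le> A" .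
    qed (auto intro: sum_nonneg)
    finally show ?thesis .
  qed
  have "(cmod (\<Sum>k\<le>m j. g k * h (m j - k)))\<^sup>2
      \<le> 2 * A * ((\<Sum>k\<in>?D j. (cmod (g k))\<^sup>2) + (\<Sum>k\<in>?D j. (cmod (h k))\<^sup>2))" for j
  proof -
    let ?n = "m j"
    let ?X = "\<Sum>k | k \<le> ?n \<and> ?n \<le> 2 * k. cmod (g k) * cmod (h (?n - k))"
    let ?Y = "\<Sum>k | k \<le> ?n \<and> ?n \<le> 2 * k. cmod (h k) * cmod (g (?n - k))"
    let ?F = "{k. k \<le> ?n \<and> ?n \<le> 2 * (?n - k)}"
    \<comment> \<open>The reflection \<open>k \<mapsto> n - k\<close> turns the terms where
      \<open>h\<close> has the large index into terms of the original Cauchy product.\<close>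
    have Y: "?Y = (\<Sum>k\<in>?F. cmod (g k) * cmod (h (?n - k)))"
      by (rule sum.reindex_bij_witness[of _ "\<lambda>k. ?n - k" "\<lambda>k. ?n - k"]) auto
    have "cmod (\<Sum>k\<le>?n. g k * h (?n - k)) \<le> (\<Sum>k\<le>?n. cmod (g k) * cmod (h (?n - k)))"
      by (rule order_trans[OF norm_sum]) (simp add: norm_mult)
    \<comment> \<open>One of \<open>k\<close> and \<open>n - k\<close> is at least
      \<open>n / 2\<close>. For even \<open>n\<close> the middle index lies in both sets; the terms
      are nonnegative, so counting it twice only enlarges the bound.\<close>
    also have "\<dots> \<le> (\<Sum>k\<in>{k. k \<le> ?n \<and> ?n \<le> 2 * k} \<union> ?F. cmod (g k) * cmod (h (?n - k)))"
      by (intro sum_mono2) auto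
    also have "\<dots> \<le> ?X + ?Y"
      unfolding Y by (subst sum.union_inter[symmetric]) (auto intro: sum_nonneg)
    finally have "(cmod (\<Sum>k\<le>?n. g k * h (?n - k)))\<^sup>2 \<le> (?X + ?Y)\<^sup>2"
      by (intro power_mono) auto
    also have "\<dots> \<le> 2 * (?X\<^sup>2 + ?Y\<^sup>2)"
      using sum_squares_bound[of ?X ?Y] by (simp add: power2_sum)
    also have "\<dots> \<le> 2 * ((\<Sum>k\<in>?D j. (cmod (g k))\<^sup>2) * A + (\<Sum>k\<in>?D j. (cmod (h k))\<^sup>2) * A)"
      by (intro mult_left_mono add_mono half g h) auto
    finally show ?thesis by (simp add: algebra_simps)
  qed
  then have "(\<Sum>j<J. (cmod (\<Sum>k\<le>m j. g k * h (m j - k)))\<^sup>2)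
      \<le> (\<Sum>j<J. 2 * A * ((\<Sum>k\<in>?D j. (cmod (g k))\<^sup>2) + (\<Sum>k\<in>?D j. (cmod (h k))\<^sup>2)))"
    by (rule sum_mono)
  also have "\<dots> = 2 * A * ((\<Sum>j<J. \<Sum>k\<in>?D j. (cmod (g k))\<^sup>2) + (\<Sum>j<J. \<Sum>k\<in>?D j. (cmod (h k))\<^sup>2))"
    by (simp add: sum.distrib flip: sum_distrib_left)
  also have "\<dots> \<le> 2 * A * (2 * A + 2 * A)"
    using A by (intro mult_left_mono add_mono sum_dyadic_overlap_le g h) auto
  finally show ?thesis by (simp add: power2_eq_square)
qed

lemma paley_poly:
  fixes p :: "complex poly"
  assumes "\<And>j. m j \<in> {2 ^ j..<2 ^ (j + 1)}"
  shows "(\<Sum>j<J. (cmod (coeff p (m j)))\<^sup>2) \<le> 8 * (integral {-pi..pi} (\<lambda>t. cmod (poly p (cis t))) / (2 * pi))\<^sup>2"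
proof -
  obtain g h where gh: "\<And>n. coeff p n = (\<Sum>k\<le>n. g k * h (n - k))"
    "\<And>K. 2 * pi * (\<Sum>k<K. (cmod (g k))\<^sup>2) \<le> integral {-pi..pi} (\<lambda>t. cmod (poly p (cis t)))"
    "\<And>K. 2 * pi * (\<Sum>k<K. (cmod (h k))\<^sup>2) \<le> integral {-pi..pi} (\<lambda>t. cmod (poly p (cis t)))"
    by (rule poly_factor_square_summable) blast
  show ?thesis
    unfolding gh(1) by (rule dyadic_cauchy_product_le[OF _ _ assms]) (use gh(2,3) in \<open>simp_all add: field_simps\<close>)
qed

section \<open>Fejer means of functions in H^1\<close>

lemma set_integrable_mult_exp:
  assumes "set_integrable lebesgue {-pi<..pi} f"
  shows "set_integrable lebesgue {-pi<..pi} (\<lambda>t. f t * exp (- (\<i> * of_int n * of_real t)))"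
  unfolding set_integrable_def
proof (rule Bochner_Integration.integrable_bound)
  show f: "integrable lebesgue (\<lambda>t. indicator {-pi<..pi} t *\<^sub>R f t)"
    using assms by (simp add: set_integrable_def)
  have "(\<lambda>t. exp (- (\<i> * of_int n * of_real t))) \<in> borel_measurable lebesgue"
    by (intro measurable_completion borel_measurable_continuous_onI continuous_intros) simp
  then have "(\<lambda>t. (indicator {-pi<..pi} t *\<^sub>R f t) * exp (- (\<i> * of_int n * of_real t))) \<in> borel_measurable lebesgue"
    by (intro borel_measurable_times borel_measurable_integrable[OF f])
  then show "(\<lambda>t. indicator {-pi<..pi} t *\<^sub>R (f t * exp (- (\<i> * of_int n * of_real t)))) \<in> borel_measurable lebesgue"
    by simp
qed (auto simp: norm_mult)

text \<open>This is \<open>N + 1\<close> times the usual Fejer kernel. As a squared modulus it is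
  visibly nonnegative and expands into a double sum of exponentials.\<close>

definition fejer_kernel :: "nat \<Rightarrow> real \<Rightarrow> real" where
  "fejer_kernel N t = (cmod (\<Sum>j\<le>N. cis (real j * t)))\<^sup>2"

lemma fejer_kernel_nonneg: "fejer_kernel N t \<ge> 0"
  by (simp add: fejer_kernel_def)

lemma of_real_fejer_kernel_diff:
  "of_real (fejer_kernel N (x - t)) =
    (\<Sum>j\<le>N. \<Sum>k\<le>N. cis (of_int (int j - int k) * x) * exp (- (\<i> * of_int (int j - int k) * of_real t)))"
proof -
  have "cis (real j * (x - t)) * cnj (cis (real k * (x - t)))
      = cis (of_int (int j - int k) * x) * exp (- (\<i> * of_int (int j - int k) * of_real t))" for j k
  proof -
    have "exp (- (\<i> * of_int (int j - int k) * of_real t)) = cis (- (of_int (int j - int k) * t))"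
      by (simp add: cis_conv_exp mult.assoc)
    then show ?thesis by (simp only: cis_cnj cis_mult) (simp add: algebra_simps)
  qed
  then show ?thesis
    unfolding fejer_kernel_def by (simp only: complex_norm_square cnj_sum sum_product)
qed

text \<open>Negative frequencies are retained, because the formula serves both for a function in H^1
  and for its modulus, which need not lie in H^1.\<close>

lemma integral_fejer_kernel:
  assumes f: "set_integrable lebesgue {-pi<..pi} f"
  shows "set_integrable lebesgue {-pi<..pi} (\<lambda>t. f t * of_real (fejer_kernel N (x - t)))"
    and "(LINT t:{-pi<..pi}|lebesgue. f t * of_real (fejer_kernel N (x - t))) =
      (\<Sum>j\<le>N. \<Sum>k\<le>N. cis (of_int (int j - int k) * x) * (2 * of_real pi * fourier_coeff f (int j - int k)))"
proof -
  define E where "E = (\<lambda>n t. indicator {-pi<..pi} t *\<^sub>R (f t * exp (- (\<i> * of_int n * of_real t))))"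
  have int: "integrable lebesgue (E n)" for n
    using set_integrable_mult_exp[OF f] by (simp add: set_integrable_def E_def)
  have E: "integral\<^sup>L lebesgue (E n) = 2 * of_real pi * fourier_coeff f n" for n
    by (simp add: fourier_coeff_def set_lebesgue_integral_def E_def)
  have eq: "indicator {-pi<..pi} t *\<^sub>R (f t * of_real (fejer_kernel N (x - t)))
      = (\<Sum>j\<le>N. \<Sum>k\<le>N. cis (of_int (int j - int k) * x) * E (int j - int k) t)" for t
    unfolding of_real_fejer_kernel_diff E_def by (simp add: sum_distrib_left scaleR_sum_right mult_ac)
  show "set_integrable lebesgue {-pi<..pi} (\<lambda>t. f t * of_real (fejer_kernel N (x - t)))"
    unfolding set_integrable_def eq
    by (intro Bochner_Integration.integrable_sum Bochner_Integration.integrable_mult_right int)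
  show "(LINT t:{-pi<..pi}|lebesgue. f t * of_real (fejer_kernel N (x - t))) =
      (\<Sum>j\<le>N. \<Sum>k\<le>N. cis (of_int (int j - int k) * x) * (2 * of_real pi * fourier_coeff f (int j - int k)))"
    unfolding set_lebesgue_integral_def eq by (simp add: Bochner_Integration.integral_sum int E)
qed

text \<open>The average of the partial sums of orders 0 to \<open>N\<close>, with
  \<open>cis x\<close> replaced by the polynomial variable. It uses nonnegative frequencies only, so
  it represents the Fejer mean for \<open>f\<close> in H^1.\<close>

definition fejer_poly :: "(real \<Rightarrow> complex) \<Rightarrow> nat \<Rightarrow> complex poly" where
  "fejer_poly f N = smult (1 / of_nat (Suc N)) (\<Sum>j\<le>N. \<Sum>k\<le>j. monom (fourier_coeff f (int k)) k)"

text \<open>For \<open>n > N\<close> the truncated subtraction makes the weight 0, as the degree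
  bound demands.\<close>

lemma coeff_fejer_poly:
  "coeff (fejer_poly f N) n = of_nat (Suc N - n) / of_nat (Suc N) * fourier_coeff f (int n)"
proof -
  have ivl: "{..N} \<inter> {j. n \<le> j} = {n..N}" by auto
  have "coeff (\<Sum>j\<le>N. \<Sum>k\<le>j. monom (fourier_coeff f (int k)) k) n
      = (\<Sum>j\<le>N. if n \<le> j then fourier_coeff f (int n) else 0)"
    by (simp add: coeff_sum)
  also have "\<dots> = (\<Sum>j\<in>{n..N}. fourier_coeff f (int n))"
    using ivl by (simp add: sum.If_cases)
  finally show ?thesis by (simp add: fejer_poly_def)
qed

lemma poly_fejer_poly_cis:
  assumes f: "f \<in> hardy_H1"
  shows "2 * of_real pi * of_nat (Suc N) * poly (fejer_poly f N) (cis x) =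
    (LINT t:{-pi<..pi}|lebesgue. f t * of_real (fejer_kernel N (x - t)))"
proof -
  have int: "set_integrable lebesgue {-pi<..pi} f" and neg: "\<And>n. n < 0 \<Longrightarrow> fourier_coeff f n = 0"
    using f by (auto simp: hardy_H1_def)
  let ?F = "\<lambda>j k. cis (of_int (int j - int k) * x) * (2 * of_real pi * fourier_coeff f (int j - int k))"
  have "(\<Sum>k\<le>N. ?F j k) = (\<Sum>k\<le>j. 2 * of_real pi * (fourier_coeff f (int k) * cis x ^ k))" if "j \<le> N" for j
  proof -
    \<comment> \<open>The terms with \<open>k > j\<close> have negative frequency
      \<open>j - k\<close> and vanish. Reversing the order of the rest gives the partial sum of
      order \<open>j\<close>.\<close>
    have "(\<Sum>k\<le>N. ?F j k) = (\<Sum>k\<le>j. ?F j k)"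
      using that by (intro sum.mono_neutral_right) (auto simp: neg)
    also have "\<dots> = (\<Sum>k\<le>j. 2 * of_real pi * (fourier_coeff f (int k) * cis x ^ k))"
      by (rule sum.reindex_bij_witness[of _ "\<lambda>k. j - k" "\<lambda>k. j - k"])
         (auto simp: Complex.DeMoivre of_nat_diff)
    finally show ?thesis .
  qed
  then have "(\<Sum>j\<le>N. \<Sum>k\<le>N. ?F j k) = (\<Sum>j\<le>N. \<Sum>k\<le>j. 2 * of_real pi * (fourier_coeff f (int k) * cis x ^ k))"
    by (rule sum.cong[OF refl]) (simp only: atMost_iff)
  also have "\<dots> = 2 * of_real pi * (\<Sum>j\<le>N. \<Sum>k\<le>j. fourier_coeff f (int k) * cis x ^ k)"
    by (simp add: sum_distrib_left)
  also have "\<dots> = 2 * of_real pi * of_nat (Suc N) * poly (fejer_poly f N) (cis x)"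
    by (simp add: fejer_poly_def poly_sum poly_monom del: of_nat_Suc)
  finally show ?thesis by (simp add: integral_fejer_kernel(2)[OF int])
qed

text \<open>The kernel is nonnegative, so the modulus of the Fejer mean of \<open>f\<close> is at
  most the Fejer mean of the modulus. The latter is a finite trigonometric sum, whose integral in
  \<open>x\<close> is computed term by term, with no interchange of integrals.\<close>

lemma norm_fejer_poly_le:
  assumes f: "f \<in> hardy_H1"
  shows "integral {-pi..pi} (\<lambda>x. cmod (poly (fejer_poly f N) (cis x))) \<le> (LINT t:{-pi<..pi}|lebesgue. cmod (f t))"
proof -
  let ?I = "{-pi<..pi}"
  let ?u = "\<lambda>t. of_real (cmod (f t)) :: complex"
  let ?S = "\<lambda>x. \<Sum>j\<le>N. \<Sum>k\<le>N. cis (of_int (int j - int k) * x) * (2 * of_real pi * fourier_coeff ?u (int j - int k))"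
  have int: "set_integrable lebesgue ?I f" 
    using f by (auto simp: hardy_H1_def)
  have intu: "set_integrable lebesgue ?I ?u"
    using integrable_of_real[OF set_integrable_norm[OF int, unfolded set_integrable_def]]
    by (simp add: set_integrable_def scaleR_conv_of_real)
  have "integral {-pi..pi} ?S = (\<Sum>j\<le>N. \<Sum>k\<le>N.
      integral {-pi..pi} (\<lambda>x. cis (of_int (int j - int k) * x)) * (2 * of_real pi * fourier_coeff ?u (int j - int k)))"
    by (subst integral_sum; (intro integrable_sum integrable_continuous_interval continuous_intros)?; simp?)+
  \<comment> \<open>Only the \<open>N + 1\<close> diagonal pairs \<open>j = k\<close> survive, each
    contributing the mean value of the modulus of \<open>f\<close>.\<close>
  also have "\<dots> = (\<Sum>j\<le>N. 2 * of_real pi * (2 * of_real pi * fourier_coeff ?u 0))"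
    by (intro sum.cong refl) (simp add: integral_cis_int if_distrib[of "\<lambda>x. x * _"] cong: if_cong del: of_int_diff)
  also have "\<dots> = of_real (2 * pi * real (Suc N) * (LINT t:?I|lebesgue. cmod (f t)))"
    by (simp add: fourier_coeff_def set_integral_complex_of_real)
  finally have S: "integral {-pi..pi} ?S = of_real (2 * pi * real (Suc N) * (LINT t:?I|lebesgue. cmod (f t)))" .
  have contS: "continuous_on {-pi..pi} ?S" by (intro continuous_intros)
  have le: "2 * pi * real (Suc N) * cmod (poly (fejer_poly f N) (cis x)) \<le> Re (?S x)" for x
  proof -
    have "2 * pi * real (Suc N) * cmod (poly (fejer_poly f N) (cis x))
        = cmod (2 * of_real pi * of_nat (Suc N) * poly (fejer_poly f N) (cis x))"
      by (simp add: norm_mult del: of_nat_Suc)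
    also have "\<dots> = cmod (LINT t:?I|lebesgue. f t * of_real (fejer_kernel N (x - t)))"
      by (simp only: poly_fejer_poly_cis[OF f])
    also have "\<dots> \<le> (LINT t:?I|lebesgue. cmod (f t * of_real (fejer_kernel N (x - t))))"
      by (intro set_integral_norm_bound integral_fejer_kernel int)
    also have "\<dots> = (LINT t:?I|lebesgue. cmod (f t) * fejer_kernel N (x - t))"
      by (simp add: norm_mult fejer_kernel_nonneg)
    also have "\<dots> = Re (LINT t:?I|lebesgue. of_real (cmod (f t) * fejer_kernel N (x - t)))"
      by (simp only: set_integral_complex_of_real Re_complex_of_real)
    also have "\<dots> = Re (?S x)"
      using integral_fejer_kernel(2)[OF intu, of N x] by simp
    finally show ?thesis .
  qed
  have "2 * pi * real (Suc N) * integral {-pi..pi} (\<lambda>x. cmod (poly (fejer_poly f N) (cis x)))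
      = integral {-pi..pi} (\<lambda>x. 2 * pi * real (Suc N) * cmod (poly (fejer_poly f N) (cis x)))"
    by simp
  also have "\<dots> \<le> integral {-pi..pi} (\<lambda>x. Re (?S x))"
    using contS by (intro integral_le le integrable_continuous_interval continuous_intros)
  also have "\<dots> = Re (integral {-pi..pi} ?S)"
    by (intro integral_linear[OF _ bounded_linear_Re, unfolded o_def] integrable_continuous_interval contS)
  also have "\<dots> = 2 * pi * real (Suc N) * (LINT t:?I|lebesgue. cmod (f t))"
    unfolding S by (rule Re_complex_of_real)
  finally show ?thesis
    by (subst (asm) mult_le_cancel_left_pos) auto
qed

section \<open>Paley's inequality and the summability theorem\<close>

theorem paley_inequality:
  assumes f: "f \<in> hardy_H1" and m: "\<And>j. m j \<in> {2 ^ j..<2 ^ (j + 1)}"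
  shows "(\<Sum>j<J. (cmod (fourier_coeff f (int (m j))))\<^sup>2) \<le> 8 * ((LINT t:{-pi<..pi}|lebesgue. cmod (f t)) / (2 * pi))\<^sup>2"
proof (rule LIMSEQ_le_const2)
  \<comment> \<open>The Fejer weights tend to 1, so the finitely many coefficients in the sum
    converge, while the bound for the Fejer polynomials does not depend on \<open>N\<close>.\<close>
  have "(\<lambda>N. of_nat (Suc N - n) / of_nat (Suc N) :: complex) \<longlonglongrightarrow> 1" for n
  proof -
    have "(\<lambda>N. 1 - of_nat n * inverse (of_nat (Suc N)) :: complex) \<longlonglongrightarrow> 1 - of_nat n * 0"
      by (intro tendsto_intros LIMSEQ_Suc lim_inverse_n)
    moreover have "\<forall>\<^sub>F N in sequentially. 1 - of_nat n * inverse (of_nat (Suc N)) = (of_nat (Suc N - n) / of_nat (Suc N) :: complex)"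
      using eventually_ge_at_top[of n]
      by eventually_elim (simp add: of_nat_diff field_simps del: of_nat_Suc)
    ultimately show ?thesis by (auto dest: Lim_transform_eventually)
  qed
  then have "(\<lambda>N. coeff (fejer_poly f N) n) \<longlonglongrightarrow> 1 * fourier_coeff f (int n)" for n
    unfolding coeff_fejer_poly by (intro tendsto_intros)
  then show "(\<lambda>N. \<Sum>j<J. (cmod (coeff (fejer_poly f N) (m j)))\<^sup>2) \<longlonglongrightarrow> (\<Sum>j<J. (cmod (fourier_coeff f (int (m j))))\<^sup>2)"
    by (intro tendsto_intros) simp
  have "(\<Sum>j<J. (cmod (coeff (fejer_poly f N) (m j)))\<^sup>2) \<le> 8 * ((LINT t:{-pi<..pi}|lebesgue. cmod (f t)) / (2 * pi))\<^sup>2" for N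
  proof -
    have "0 \<le> integral {-pi..pi} (\<lambda>x. cmod (poly (fejer_poly f N) (cis x)))"
      by (intro integral_nonneg integrable_continuous_interval continuous_intros) auto
    then have "8 * (integral {-pi..pi} (\<lambda>x. cmod (poly (fejer_poly f N) (cis x))) / (2 * pi))\<^sup>2
        \<le> 8 * ((LINT t:{-pi<..pi}|lebesgue. cmod (f t)) / (2 * pi))\<^sup>2"
      by (intro mult_left_mono power_mono divide_right_mono norm_fejer_poly_le f) auto
    with paley_poly[OF m] show ?thesis by (rule order_trans)
  qed
  then show "\<exists>N0. \<forall>N\<ge>N0. (\<Sum>j<J. (cmod (coeff (fejer_poly f N) (m j)))\<^sup>2) \<le> 8 * ((LINT t:{-pi<..pi}|lebesgue. cmod (f t)) / (2 * pi))\<^sup>2"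
    by blast
qed

text \<open>The index 0 lies in no dyadic block and is split off.\<close>

lemma sum_dyadic_blocks:
  fixes y :: "nat \<Rightarrow> 'a::comm_monoid_add"
  shows "(\<Sum>n<2 ^ J. y n) = y 0 + (\<Sum>j<J. \<Sum>n\<in>{2 ^ j..<2 ^ (j + 1)}. y n)"
proof (induction J)
  case (Suc J)
  have "(\<Sum>n<2 ^ Suc J. y n) = (\<Sum>n<2 ^ J. y n) + (\<Sum>n\<in>{2 ^ J..<2 ^ (J + 1)}. y n)"
    unfolding lessThan_atLeast0 by (subst sum.atLeastLessThan_concat) simp_all
  with Suc show ?case by (simp add: add.assoc)
qed simp

theorem lemma1p4:
  fixes a :: "nat \<Rightarrow> complex"
  assumes "summable (\<lambda>j::nat. (\<Sum>n\<in>{2 ^ j..<2 ^ (j + 1)}. norm (a n)) ^ 2)"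
  shows "\<forall>f\<in>hardy_H1. summable (\<lambda>n::nat. norm (a n * fourier_coeff f (int n)))"
proof
  fix f assume f: "f \<in> hardy_H1"
  let ?B = "\<lambda>j::nat. {2 ^ j..<2 ^ (j + 1)::nat}"
  let ?c = "\<lambda>n. cmod (fourier_coeff f (int n))"
  let ?A = "\<lambda>j. \<Sum>n\<in>?B j. cmod (a n)"
  have "\<exists>m\<in>?B j. \<forall>n\<in>?B j. ?c n \<le> ?c m" for j
  proof -
    have fin: "finite (?c ` ?B j)" and ne: "?c ` ?B j \<noteq> {}" by auto
    from Max_in[OF fin ne] obtain m where "m \<in> ?B j" "Max (?c ` ?B j) = ?c m" by blast
    with Max_ge[OF fin] show ?thesis by (metis imageI)
  qed
  then obtain m where m: "\<And>j. m j \<in> ?B j" "\<And>j n. n \<in> ?B j \<Longrightarrow> ?c n \<le> ?c (m j)"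
    by metis
  define L where "L = 8 * ((LINT t:{-pi<..pi}|lebesgue. cmod (f t)) / (2 * pi))\<^sup>2"
  show "summable (\<lambda>n. norm (a n * fourier_coeff f (int n)))"
  proof (rule summableI_nonneg_bounded)
    fix N :: nat
    \<comment> \<open>Since \<open>N < 2 ^ N\<close>, the partial sum is completed to whole dyadic
      blocks.\<close>
    have "(\<Sum>n<N. norm (a n * fourier_coeff f (int n))) \<le> (\<Sum>n<2 ^ N. norm (a n * fourier_coeff f (int n)))"
      by (intro sum_mono2) (auto intro: less_trans less_exp)
    also have "\<dots> = cmod (a 0 * fourier_coeff f 0) + (\<Sum>j<N. \<Sum>n\<in>?B j. cmod (a n) * ?c n)"
      by (simp add: sum_dyadic_blocks norm_mult)
    also have "(\<Sum>j<N. \<Sum>n\<in>?B j. cmod (a n) * ?c n) \<le> (\<Sum>j<N. ((?A j)\<^sup>2 + (?c (m j))\<^sup>2) / 2)"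
    proof (rule sum_mono)
      fix j
      have "(\<Sum>n\<in>?B j. cmod (a n) * ?c n) \<le> ?A j * ?c (m j)"
        unfolding sum_distrib_right by (intro sum_mono mult_left_mono m) auto
      \<comment> \<open>The inequality \<open>2 * x * y \<le> x^2 + y^2\<close> stands in for
        Cauchy-Schwarz: any bound independent of \<open>N\<close> is enough, and both square sums
        have one.\<close>
      also have "\<dots> \<le> ((?A j)\<^sup>2 + (?c (m j))\<^sup>2) / 2"
        using sum_squares_bound[of "?A j" "?c (m j)"] by simp
      finally show "(\<Sum>n\<in>?B j. cmod (a n) * ?c n) \<le> ((?A j)\<^sup>2 + (?c (m j))\<^sup>2) / 2" .
    qed
    also have "\<dots> = ((\<Sum>j<N. (?A j)\<^sup>2) + (\<Sum>j<N. (?c (m j))\<^sup>2)) / 2"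
      by (simp add: sum.distrib flip: sum_divide_distrib)
    also have "\<dots> \<le> ((\<Sum>j. (?A j)\<^sup>2) + L) / 2"
      unfolding L_def using assms
      by (intro divide_right_mono add_mono sum_le_suminf paley_inequality f m(1)) auto
    finally show "(\<Sum>n<N. norm (a n * fourier_coeff f (int n)))
        \<le> cmod (a 0 * fourier_coeff f 0) + ((\<Sum>j. (?A j)\<^sup>2) + L) / 2" by simp
  qed simp
qed

end
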